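(* Let $S=\{i_1<i_2<\dots<i_s=m\}$ be a nonempty admissible set. For integers $0\le j\le m-1$ define $$d_j^S = (-1)^{m-j-1}\,(-2)^{|S\cap(j,\infty)|-1}\,p_{S\cap[j]}(j).$$ If there exists an index $1\le r\le s-1$ such that $i_{r+1}-i_r$ is odd, let $b=i_r$ for the largest such $r$; then $$p_S(x)=\sum_{j=b}^{m-1} d_j^S\binom{x}{j}.$$ Otherwise (no such $r$ exists), $$p_S(x)=\left(d_0^S-(-2)^{|S|-1}\right)+\sum_{j=1}^{m-1} d_j^S\binom{x}{j}.$$
   Context: For a permutation $\pi=\pi_1\cdots\pi_n\in\mathfrak S_n$, an index $1<i<n$ is a peak if $\pi_{i-1}<\pi_i>\pi_{i+1}$; $P(\pi)$ is the set of peaks of $\pi$, and $\mathcal P_S(n)=\{\pi\in\mathfrak S_n: P(\pi)=S\}$. A finite set $S$ of positive integers is admissible if $\mathcal P_S(n)\neq\emptyset$ for some $n$; equivalently $1\notin S$ and $S$ contains no two consecutive integers. Known fact (Billey–Burdzy–Sagan): for a nonempty admissible $S$ with $m=\max(S)$ there is a unique polynomial $p_S(x)$, of degree $m-1$ and integer-valued on integers, such that $|\mathcal P_S(n)|=p_S(n)2^{n-|S|-1}$ for all $n\ge m$; for $S=\emptyset$, $|\mathcal P_\emptyset(n)|=2^{n-1}$ and $p_\emptyset(x)=1$. If $S$ is not admissible, $p_S(x)=0$. $p_S$ is called the peak polynomial of $S$. Notation: $[j]=\{1,2,\dots,j\}$, $[0]=\emptyset$, and $\binom{x}{j}=x(x-1)\cdots(x-j+1)/j!$.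 *)

theory Defs
  imports Complex_Main "HOL-Combinatorics.Permutations"
    "HOL-Computational_Algebra.Polynomial"
begin

definition peaks :: "nat \<Rightarrow> (nat \<Rightarrow> nat) \<Rightarrow> nat set" where
  "peaks n \<pi> = {i. 1 < i \<and> i < n \<and> \<pi> (i - 1) < \<pi> i \<and> \<pi> i > \<pi> (i + 1)}"

definition perms_with_peaks :: "nat set \<Rightarrow> nat \<Rightarrow> (nat \<Rightarrow> nat) set" where
  "perms_with_peaks S n = {\<pi>. \<pi> permutes {1..n} \<and> peaks n \<pi> = S}"

definition admissible :: "nat set \<Rightarrow> bool" where
  "admissible S \<longleftrightarrow> finite S \<and> 0 \<notin> S \<and> (\<exists>n. perms_with_peaks S n \<noteq> {})"

(* The counting identity at infinitely many n determines the polynomial; that it exists, has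
   degree Max S - 1 and is integer-valued is the theorem of Billey, Burdzy and Sagan.
   A nonempty admissible S satisfies 2 * card S \<le> Max S, so the exponent is not truncated. *)
definition peak_poly :: "nat set \<Rightarrow> real poly" where
  "peak_poly S =
     (if \<not> admissible S then 0
      else if S = {} then 1
      else (THE p. \<forall>n\<ge>Max S.
              real (card (perms_with_peaks S n)) = poly p (real n) * 2 ^ (n - card S - 1)))"

(* Intended for 0 \<le> j < Max S, where both natural number subtractions are exact. *)
definition peak_coeff :: "nat set \<Rightarrow> nat \<Rightarrow> real" where
  "peak_coeff S j =
     (-1) ^ (Max S - j - 1) * (-2) ^ (card (S \<inter> {j<..}) - 1)
       * poly (peak_poly (S \<inter> {1..j})) (real j)"

(* The r-th smallest element i_r of S, counted from r = 1. *)
definition nth_elem :: "nat set \<Rightarrow> nat \<Rightarrow> nat" where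
  "nth_elem S r = sorted_list_of_set S ! (r - 1)"

definition odd_gap_indices :: "nat set \<Rightarrow> nat set" where
  "odd_gap_indices S =
     {r. 1 \<le> r \<and> r \<le> card S - 1 \<and> odd (nth_elem S (r + 1) - nth_elem S r)}"

end

(* Cutting a permutation of [n] after position k = max S - 1 and prescribing the peaks T = S - {max S}
   on the first part and none on the second gives, with U = T \<union> {k},
     binomial(n, k) |P_T(k)| 2^(n-k-1) = |P_T(n)| + |P_U(n)| + |P_S(n)|,
   hence p_S(x) = p_T(k) binomial(x, k) - 2 p_T(x) - p_U(x).
   Moving max S down by one flips the sign of d_j, and deleting it multiplies d_j for j < max T by
   -1/2 or 1/2 according to whether the last gap is even or odd.  The last gaps of S and U have
   opposite parity, so by induction on max S exactly one of the two subtracted terms contributes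
   below max T when the last gap of S is even, and both cancel when it is odd. *)
theory Submission
  imports Defs "HOL-Combinatorics.Multiset_Permutations" "HOL-Library.Infinite_Set"
begin

subsection \<open>Peaks of lists\<close>

text \<open>Peaks are positions counted from 1, as in \<^const>\<open>peaks\<close>, whereas \<open>!\<close> counts from 0.\<close>

definition list_peaks :: "nat list \<Rightarrow> nat set" where
  "list_peaks xs = {i. 1 < i \<and> i < length xs \<and> xs ! (i - 2) < xs ! (i - 1) \<and> xs ! i < xs ! (i - 1)}"

definition peak_lists :: "nat set \<Rightarrow> nat set \<Rightarrow> nat list set" where
  "peak_lists A S = {xs \<in> permutations_of_set A. list_peaks xs = S}"

lemma finite_peak_lists [simp]: "finite (peak_lists A S)"
  by (simp add: peak_lists_def)

lemma list_peaks_map: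
  assumes "strict_mono_on A f" "set xs \<subseteq> A"
  shows "list_peaks (map f xs) = list_peaks xs"
proof -
  have "f (xs ! i) < f (xs ! j) \<longleftrightarrow> xs ! i < xs ! j" if "i < length xs" "j < length xs" for i j
    using strict_mono_on_less[OF assms(1)] assms(2) that by (meson nth_mem subsetD)
  then show ?thesis
    by (auto simp: list_peaks_def)
qed

lemma card_peak_lists_image:
  assumes "strict_mono_on A f"
  shows "card (peak_lists (f ` A) S) = card (peak_lists A S)"
proof -
  have inj: "inj_on f A"
    using assms strict_mono_on_imp_inj_on by blast
  have "bij_betw (map f) (permutations_of_set A) (permutations_of_set (f ` A))"
    unfolding bij_betw_def permutations_of_set_image_inj[OF inj]
    using inj by (auto intro!: inj_on_mapI intro: inj_on_subset simp: permutations_of_set_def)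
  moreover have "list_peaks (map f xs) = list_peaks xs" if "xs \<in> permutations_of_set A" for xs
    using that by (intro list_peaks_map[OF assms]) (simp add: permutations_of_set_def)
  ultimately have "bij_betw (map f) (peak_lists A S) (peak_lists (f ` A) S)"
    unfolding peak_lists_def by (intro bij_betw_Collect) auto
  then show ?thesis
    by (simp add: bij_betw_same_card)
qed

text \<open>Standardisation: peaks depend only on the relative order of the entries, so the
  increasing enumeration of \<open>A\<close> transports the count.\<close>

lemma card_peak_lists_lessThan:
  assumes "finite A"
  shows "card (peak_lists A S) = card (peak_lists {..<card A} S)"
proof -
  obtain h where h: "bij_betw h {..<card A} A" "strict_mono_on {..<card A} h"
    using ex_bij_betw_strict_mono_card[OF assms] by blast
  with card_peak_lists_image[OF h(2)] show ?thesis
    by (simp add: bij_betw_def)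
qed

lemma card_peak_lists_cong:
  assumes "finite A" "finite B" "card A = card B"
  shows "card (peak_lists A S) = card (peak_lists B S)"
  using card_peak_lists_lessThan[OF assms(1)] card_peak_lists_lessThan[OF assms(2)] assms(3)
  by simp

lemma list_peaks_map_upt: "list_peaks (map f [Suc 0..<Suc n]) = peaks n f"
proof (intro set_eqI)
  fix i
  have "Suc (i - 2) = i - 1" "Suc (i - 1) = i" if "1 < i" using that by auto
  then show "i \<in> list_peaks (map f [Suc 0..<Suc n]) \<longleftrightarrow> i \<in> peaks n f"
    unfolding list_peaks_def peaks_def by (auto simp del: upt_Suc)
qed

text \<open>One-line notation turns permutations into lists, which can be cut in two and may have
  arbitrary value sets.\<close>

lemma card_perms_with_peaks:
  "card (perms_with_peaks S n) = card (peak_lists {1..n} S)"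
proof -
  have bij: "bij_betw (\<lambda>\<pi>. map \<pi> [1..<Suc n]) {\<pi>. \<pi> permutes {1..n}} (permutations_of_set {1..n})"
    unfolding bij_betw_def
  proof (intro conjI inj_onI ext)
    fix \<pi> \<sigma> x
    assume *: "\<pi> \<in> {\<pi>. \<pi> permutes {1..n}}" "\<sigma> \<in> {\<pi>. \<pi> permutes {1..n}}"
      "map \<pi> [1..<Suc n] = map \<sigma> [1..<Suc n]"
    show "\<pi> x = \<sigma> x"
    proof (cases "x \<in> {1..n}")
      case True
      with *(3) show ?thesis by (simp del: upt_Suc)
    next
      case False
      with *(1,2) show ?thesis by (metis mem_Collect_eq permutes_not_in)
    qed
  next
    have "map \<pi> [1..<Suc n] \<in> permutations_of_set {1..n}" if "\<pi> permutes {1..n}" for \<pi>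
      using permutes_inj_on[OF that] permutes_image[OF that]
      by (simp add: permutations_of_set_def distinct_map atLeastLessThanSuc_atLeastAtMost del: upt_Suc)
    moreover have "\<exists>\<pi>. \<pi> permutes {1..n} \<and> map \<pi> [1..<Suc n] = xs"
      if xs: "xs \<in> permutations_of_set {1..n}" for xs
    proof -
      \<comment> \<open>\<open>permutes\<close> requires the identity outside \<open>{1..n}\<close>;
        inside, the shift by one converts positions to list indices.\<close>
      let ?\<pi> = "\<lambda>i. if i \<in> {1..n} then xs ! (i - 1) else i"
      have len: "length xs = n"
        using length_finite_permutations_of_set[OF xs] by simp
      then have map: "map ?\<pi> [1..<Suc n] = xs"
        by (auto intro!: nth_equalityI simp del: upt_Suc)
      have "set xs = ?\<pi> ` {1..n}"
        by (subst map[symmetric]) (simp only: set_map set_upt atLeastLessThanSuc_atLeastAtMost)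
      moreover have "inj_on ?\<pi> {1..n}"
        using xs len by (auto intro!: inj_onI simp: permutations_of_set_def nth_eq_iff_index_eq)
      ultimately have "bij_betw ?\<pi> {1..n} {1..n}"
        using xs by (simp only: bij_betw_def permutations_of_set_def) simp
      then have "?\<pi> permutes {1..n}"
        by (rule bij_imp_permutes) (simp only: if_False)
      with map show ?thesis by blast
    qed
    ultimately show "(\<lambda>\<pi>. map \<pi> [1..<Suc n]) ` {\<pi>. \<pi> permutes {1..n}} = permutations_of_set {1..n}"
      by blast
  qed
  have "bij_betw (\<lambda>\<pi>. map \<pi> [1..<Suc n]) (perms_with_peaks S n) (peak_lists {1..n} S)"
    using bij_betw_Collect[OF bij, of "\<lambda>xs. list_peaks xs = S" "\<lambda>\<pi>. peaks n \<pi> = S"]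
    by (simp add: peak_lists_def perms_with_peaks_def list_peaks_map_upt del: upt_Suc)
  then show ?thesis
    by (rule bij_betw_same_card)
qed

section \<open>Peaks of a concatenation\<close>

lemma list_peaks_bounds: "i \<in> list_peaks xs \<Longrightarrow> 1 < i \<and> i < length xs"
  by (simp add: list_peaks_def)

lemma list_peaks_Suc: "i \<in> list_peaks xs \<Longrightarrow> Suc i \<notin> list_peaks xs"
  by (auto simp: list_peaks_def Suc_diff_Suc numeral_2_eq_2)

lemma list_peaks_append_left:
  "i < length ys \<Longrightarrow> i \<in> list_peaks (ys @ zs) \<longleftrightarrow> i \<in> list_peaks ys"
  by (auto simp: list_peaks_def nth_append)

lemma list_peaks_append_right:
  assumes "length ys + 1 < i"
  shows "i \<in> list_peaks (ys @ zs) \<longleftrightarrow> i - length ys \<in> list_peaks zs"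
proof -
  have "i = length ys + ((i - length ys - 2) + 2)"
    using assms by simp
  then obtain j where "i = length ys + (j + 2)" by blast
  then show ?thesis
    by (auto simp: list_peaks_def nth_append)
qed

text \<open>A peak is decided by a position and its two neighbours, so every position except the two
  at the cut is settled inside one part.\<close>

lemma list_peaks_append_iff:
  assumes "S \<subseteq> {..<length ys}"
  defines "k \<equiv> length ys"
  shows "list_peaks ys = S \<and> list_peaks zs = {} \<longleftrightarrow>
     list_peaks (ys @ zs) \<in> {S, insert k S, insert (Suc k) S}" (is "?L \<longleftrightarrow> ?R")
proof
  assume L: ?L
  have sub: "list_peaks (ys @ zs) - {k, Suc k} = S"
  proof (intro set_eqI)
    fix i
    consider "i < k" | "i = k" | "i = Suc k" | "Suc k < i" by linarith
    then show "i \<in> list_peaks (ys @ zs) - {k, Suc k} \<longleftrightarrow> i \<in> S"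
      using L assms list_peaks_append_left[of i ys zs] list_peaks_append_right[of ys i zs]
      by cases auto
  qed
  \<comment> \<open>Adjacent positions are never both peaks, which rules out
    \<open>insert k (insert (Suc k) S)\<close>.\<close>
  show ?R
    using list_peaks_Suc[of k "ys @ zs"] sub by blast
next
  assume R: ?R
  have "i \<in> list_peaks ys \<longleftrightarrow> i \<in> S" for i
  proof (cases "i < k")
    case True
    then show ?thesis
      using R assms list_peaks_append_left[of i ys zs] by auto
  next
    case False
    then show ?thesis
      using assms list_peaks_bounds[of i ys] by auto
  qed
  moreover have "i \<notin> list_peaks zs" for i
    using R assms list_peaks_append_right[of ys "i + k" zs] list_peaks_bounds[of i zs] 
    by auto
  ultimately show ?L by blast
qed

text \<open>
  Cut a list after its first \<open>k\<close> entries: prescribing the peaks of both parts leaves open only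
  whether there is a peak at \<open>k\<close> or at \<open>k + 1\<close>, and not both can occur.
\<close>

lemma card_peak_lists_split:
  fixes A :: "nat set"
  assumes A: "finite A" "card A = k + l" and S: "S \<subseteq> {..<k}"
  shows "card (peak_lists A S) + card (peak_lists A (insert k S)) + card (peak_lists A (insert (Suc k) S))
     = (k + l choose k) * card (peak_lists {..<k} S) * card (peak_lists {..<l} {})"
proof -
  \<comment> \<open>The component \<open>B\<close> records which values go into the first
    \<open>k\<close> entries.\<close>
  define I where "I = (SIGMA B:{B. B \<subseteq> A \<and> card B = k}. peak_lists B S \<times> peak_lists (A - B) {})"
  define U where "U = peak_lists A S \<union> peak_lists A (insert k S) \<union> peak_lists A (insert (Suc k) S)"
  have fin: "finite B" if "B \<subseteq> A" for B using that A finite_subset by blast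
  have len: "length xs = card B" if "xs \<in> peak_lists B T" for xs B T
    using that length_finite_permutations_of_set by (auto simp: peak_lists_def)
  have "bij_betw (\<lambda>(B, ys, zs). ys @ zs) I U"
  proof (rule bij_betw_byWitness[where f' = "\<lambda>xs. (set (take k xs), take k xs, drop k xs)"])
    show "\<forall>a\<in>I. (\<lambda>xs. (set (take k xs), take k xs, drop k xs)) ((\<lambda>(B, ys, zs). ys @ zs) a) = a"
      using len by (auto simp: I_def peak_lists_def permutations_of_set_def)
    show "\<forall>a'\<in>U. (\<lambda>(B, ys, zs). ys @ zs) ((\<lambda>xs. (set (take k xs), take k xs, drop k xs)) a') = a'"
      by simp
    show "(\<lambda>(B, ys, zs). ys @ zs) ` I \<subseteq> U"
    proof clarify
      fix B ys zs assume *: "(B, ys, zs) \<in> I"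
      then have "length ys = k" using len by (auto simp: I_def)
      with * have "list_peaks (ys @ zs) \<in> {S, insert k S, insert (Suc k) S}"
        using S by (subst list_peaks_append_iff[symmetric, of S ys zs, simplified \<open>length ys = k\<close>])
          (auto simp: I_def peak_lists_def)
      moreover have "ys @ zs \<in> permutations_of_set A"
        using * by (auto simp: I_def peak_lists_def permutations_of_set_def)
      ultimately show "ys @ zs \<in> U" by (auto simp: U_def peak_lists_def)
    qed
    show "(\<lambda>xs. (set (take k xs), take k xs, drop k xs)) ` U \<subseteq> I"
    proof clarify
      fix xs assume "xs \<in> U"
      then have p: "set xs = A" "distinct xs" and q: "list_peaks xs \<in> {S, insert k S, insert (Suc k) S}"
        by (auto simp: U_def peak_lists_def permutations_of_set_def)
      have l: "length xs = k + l" using p A distinct_card by metis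
      then have lk: "length (take k xs) = k" by simp
      have "list_peaks (take k xs) = S \<and> list_peaks (drop k xs) = {}"
        using q S lk by (subst list_peaks_append_iff) (auto simp del: length_take)
      moreover have "set (take k xs) \<union> set (drop k xs) = A"
        using p by (metis append_take_drop_id set_append)
      moreover have "set (take k xs) \<inter> set (drop k xs) = {}"
        using p(2) by (simp add: set_take_disj_set_drop_if_distinct)
      moreover have "card (set (take k xs)) = k"
        using p(2) lk by (metis distinct_card distinct_take)
      ultimately show "(set (take k xs), take k xs, drop k xs) \<in> I"
        using p(2) by (auto simp: I_def peak_lists_def permutations_of_set_def)
    qed
  qed
  then have "card U = card I"
    by (simp add: bij_betw_same_card)
  also have "\<dots> = (\<Sum>B | B \<subseteq> A \<and> card B = k. card (peak_lists B S) * card (peak_lists (A - B) {}))"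
    unfolding I_def using A by (subst card_SigmaI) (auto simp: card_cartesian_product)
  \<comment> \<open>After standardisation the summand no longer depends on \<open>B\<close>, which
    leaves the number of \<open>k\<close>-subsets of \<open>A\<close>.\<close>
  also have "\<dots> = (\<Sum>B | B \<subseteq> A \<and> card B = k. card (peak_lists {..<k} S) * card (peak_lists {..<l} {}))"
  proof (intro sum.cong refl)
    fix B assume B: "B \<in> {B. B \<subseteq> A \<and> card B = k}"
    with fin A have "card (A - B) = l" by (simp add: card_Diff_subset)
    with B fin A show "card (peak_lists B S) * card (peak_lists (A - B) {})
      = card (peak_lists {..<k} S) * card (peak_lists {..<l} {})"
      using card_peak_lists_lessThan[of B S] card_peak_lists_lessThan[of "A - B" "{}"] by simp
  qed
  also have "\<dots> = (k + l choose k) * card (peak_lists {..<k} S) * card (peak_lists {..<l} {})"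
    using n_subsets[OF A(1), of k] A(2) by simp
  finally have "card U = \<dots>" .
  moreover have "card U = card (peak_lists A S) + card (peak_lists A (insert k S)) + card (peak_lists A (insert (Suc k) S))"
  proof -
    have "k \<notin> S" "Suc k \<notin> S" using S by auto
    then have "S \<noteq> insert k S" "S \<noteq> insert (Suc k) S" "insert k S \<noteq> insert (Suc k) S" by auto
    then show ?thesis
      unfolding U_def by (subst card_Un_disjoint; (subst card_Un_disjoint)?) (auto simp: peak_lists_def)
  qed
  ultimately show ?thesis by simp
qed

text \<open>In a list without peaks the maximum stands at one of the two ends.\<close>

lemma card_peakless_lists:
  "card (peak_lists {..<Suc n} {}) = 2 ^ n"
proof (induction n)
  case 0
  have "peak_lists {..<Suc 0} {} = {[0]}"
    by (auto simp: peak_lists_def list_peaks_def lessThan_Suc)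
  then show ?case by simp
next
  case (Suc n)
  let ?P = "peak_lists {..<Suc n} {}" and ?m = "Suc n"
  \<comment> \<open>Behind a leading maximum, position 2 cannot be a peak; the peaks of
    \<open>ys\<close> just move up by one.\<close>
  have at_front: "list_peaks (?m # ys) = {} \<longleftrightarrow> list_peaks ys = {}" if "set ys = {..<Suc n}" for ys
  proof -
    have "i \<in> list_peaks (?m # ys) \<longleftrightarrow> 2 < i \<and> i - 1 \<in> list_peaks ys" for i
    proof (cases "2 < i")
      case True
      then show ?thesis
        using list_peaks_append_right[of "[?m]" i ys] by simp
    next
      case False
      have "ys ! 0 < ?m" if "Suc 0 < length ys"
        using nth_mem[of 0 ys] that \<open>set ys = {..<Suc n}\<close> by force
      with False show ?thesis
        by (cases "i = 2") (auto simp: list_peaks_def)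
    qed
    moreover have "2 < Suc i" if "i \<in> list_peaks ys" for i
      using that list_peaks_bounds by fastforce
    ultimately show ?thesis
      by (metis all_not_in_conv diff_Suc_1)
  qed
  \<comment> \<open>The old last entry does not become a peak, since a larger entry now follows
    it.\<close>
  have at_end: "list_peaks (ys @ [?m]) = list_peaks ys" if "set ys = {..<Suc n}" for ys
  proof -
    have "i \<in> list_peaks (ys @ [?m]) \<longleftrightarrow> i \<in> list_peaks ys" for i
    proof (cases "i < length ys")
      case False
      have "ys ! (i - 1) < ?m" if "i = length ys" "1 < i"
        using that \<open>set ys = {..<Suc n}\<close> by (metis One_nat_def diff_less lessThan_iff less_trans nth_mem zero_less_one)
      with False show ?thesis
        by (cases "i = length ys") (auto simp: list_peaks_def nth_append)
    qed (simp add: list_peaks_append_left)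
    then show ?thesis by blast
  qed
  have "peak_lists {..<Suc (Suc n)} {} = (#) ?m ` ?P \<union> (\<lambda>ys. ys @ [?m]) ` ?P" (is "?L = ?R")
  proof
    show "?R \<subseteq> ?L"
      unfolding peak_lists_def permutations_of_set_def lessThan_Suc[of ?m]
      by (simp add: image_subset_iff at_front at_end)
    show "?L \<subseteq> ?R"
    proof
      fix xs assume xs: "xs \<in> ?L"
      then have set: "set xs = {..<Suc (Suc n)}" and dist: "distinct xs" and np: "list_peaks xs = {}"
        by (auto simp: peak_lists_def permutations_of_set_def)
      then have "?m \<in> set xs" by simp
      then obtain ys zs where eq: "xs = ys @ ?m # zs"
        by (meson split_list)
      have less: "y < ?m" if "y \<in> set ys \<union> set zs" for y
      proof -
        have "y \<noteq> ?m" "y \<in> set xs" using dist that by (auto simp: eq)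
        with set show ?thesis by auto
      qed
      have sets: "set ys \<union> set zs = {..<Suc n}"
      proof -
        have "set ys \<union> set zs = set xs - {?m}" using dist by (auto simp: eq)
        also have "\<dots> = {..<Suc n}" by (auto simp: set)
        finally show ?thesis .
      qed
      \<comment> \<open>An interior maximum would itself be a peak.\<close>
      have "ys = [] \<or> zs = []"
      proof (rule ccontr)
        assume "\<not> ?thesis"
        then have "ys \<noteq> []" "zs \<noteq> []" by auto
        then have "Suc (length ys) \<in> list_peaks xs"
          using less by (auto simp: list_peaks_def eq nth_append Suc_diff_le)
        with np show False by simp
      qed
      then show "xs \<in> ?R"
        using sets dist np at_front at_end
        by (auto simp: eq peak_lists_def permutations_of_set_def)
    qed
  qed
  moreover have "card (?R) = 2 * card ?P"
  proof -
    \<comment> \<open>A common element would force \<open>zs\<close> to be empty or to start with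
      \<open>?m\<close>, and neither fits its set of entries.\<close>
    have "(#) ?m ` ?P \<inter> (\<lambda>ys. ys @ [?m]) ` ?P = {}"
    proof (rule ccontr)
      assume "\<not> ?thesis"
      then obtain ys zs where *: "ys \<in> ?P" "zs \<in> ?P" "?m # ys = zs @ [?m]" by auto
      then have "set zs = {..<Suc n}" by (simp add: peak_lists_def permutations_of_set_def)
      with *(3) show False by (cases zs) auto
    qed
    then show ?thesis
      by (simp add: card_Un_disjoint card_image inj_on_def)
  qed
  ultimately show ?case using Suc.IH by simp
qed

subsection \<open>The recursion for peak polynomials\<close>

lemma card_perms_with_peaks_empty: "card (perms_with_peaks {} (Suc n)) = 2 ^ n"
  using card_peak_lists_lessThan[of "{1..Suc n}" "{}"]
  by (simp only: card_perms_with_peaks card_peakless_lists finite_atLeastAtMost card_atLeastAtMost diff_Suc_1)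

text \<open>The cut identity for permutations. Since \<open>k < n\<close>, the second part is
  nonempty and has \<open>2 ^ (n - Suc k)\<close> peakless arrangements.\<close>

lemma card_perms_with_peaks_rec:
  assumes "S \<subseteq> {..<k}" "k < n"
  shows "card (perms_with_peaks S n) + card (perms_with_peaks (insert k S) n)
           + card (perms_with_peaks (insert (Suc k) S) n)
       = (n choose k) * card (perms_with_peaks S k) * 2 ^ (n - Suc k)"
proof -
  obtain l where "n = Suc (k + l)"
    using assms(2) less_imp_Suc_add by blast
  then have l: "n = k + Suc l" by simp
  show ?thesis
    unfolding card_perms_with_peaks
    using card_peak_lists_split[of "{1..n}" k "Suc l" S] assms(1) card_peak_lists_lessThan[of "{1..k}" S]
    by (simp add: l card_peakless_lists)
qed

section \<open>Characterisation of admissible sets\<close>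

lemma peaks_bounds: "i \<in> peaks n \<pi> \<Longrightarrow> 1 < i \<and> i < n"
  by (simp add: peaks_def)

lemma peaks_Suc: "i \<in> peaks n \<pi> \<Longrightarrow> Suc i \<notin> peaks n \<pi>"
  by (auto simp: peaks_def)

lemma perms_with_peaks_eq_empty:
  assumes "0 \<in> S \<or> 1 \<in> S \<or> (\<exists>i\<ge>n. i \<in> S) \<or> (\<exists>i. i \<in> S \<and> Suc i \<in> S)"
  shows "perms_with_peaks S n = {}"
proof -
  have False if "peaks n \<pi> = S" for \<pi>
    using assms peaks_bounds[of 0 n \<pi>] peaks_bounds[of 1 n \<pi>] peaks_bounds[of _ n \<pi>] 
      peaks_Suc[of _ n \<pi>] unfolding that by (metis less_irrefl not_less not_less_zero)
  then show ?thesis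
    by (auto simp: perms_with_peaks_def)
qed

lemma admissible_iff:
  "admissible S \<longleftrightarrow> finite S \<and> 0 \<notin> S \<and> 1 \<notin> S \<and> (\<forall>i\<in>S. Suc i \<notin> S)"
proof
  assume "admissible S"
  then show "finite S \<and> 0 \<notin> S \<and> 1 \<notin> S \<and> (\<forall>i\<in>S. Suc i \<notin> S)"
    unfolding admissible_def using perms_with_peaks_eq_empty by blast
next
  assume S: "finite S \<and> 0 \<notin> S \<and> 1 \<notin> S \<and> (\<forall>i\<in>S. Suc i \<notin> S)"
  then obtain n where n: "S \<subseteq> {..<n}"
    using finite_nat_iff_bounded by blast
  \<comment> \<open>Raising the entries at positions in \<open>S\<close> above all others makes
    these positions peaks; at every other position the next entry is larger. The values may exceed
    \<open>n\<close>, so the image is standardised at the end.\<close>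
  define f where "f i = (if i \<in> S then n + i else i)" for i
  have inj: "inj_on f {1..n}"
    using n by (auto simp: f_def inj_on_def split: if_splits)
  have "peaks n f = S"
  proof (intro set_eqI)
    fix i
    show "i \<in> peaks n f \<longleftrightarrow> i \<in> S"
    proof (cases "i \<in> S")
      case True
      then have "i \<noteq> 0" "i \<noteq> 1"
        using S by metis+
      then have "1 < i" "Suc (i - 1) = i" by simp_all
      moreover from this True have "i - 1 \<notin> S" "i + 1 \<notin> S" "i < n"
        using S n by (metis, auto)
      ultimately show ?thesis using True by (simp add: peaks_def f_def)
    qed (auto simp: peaks_def f_def)
  qed
  moreover have "map f [Suc 0..<Suc n] \<in> permutations_of_set (f ` {1..n})"
    using inj by (simp add: permutations_of_set_def distinct_map atLeastLessThanSuc_atLeastAtMost del: upt_Suc)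
  ultimately have "peak_lists (f ` {1..n}) S \<noteq> {}"
    unfolding peak_lists_def using list_peaks_map_upt[of f n] by blast
  then have "card (peak_lists (f ` {1..n}) S) \<noteq> 0" by simp
  moreover have "card (perms_with_peaks S n) = card (peak_lists (f ` {1..n}) S)"
    using card_peak_lists_cong[of "f ` {1..n}" "{1..n}" S] inj
    by (simp add: card_perms_with_peaks card_image)
  ultimately have "perms_with_peaks S n \<noteq> {}"
    by force
  with S show "admissible S"
    unfolding admissible_def by blast
qed

section \<open>Existence and uniqueness of peak polynomials\<close>

definition gchoose_poly :: "nat \<Rightarrow> real poly" where
  "gchoose_poly k = smult (1 / fact k) (\<Prod>i<k. [:- real i, 1:])"

lemma poly_gchoose_poly: "poly (gchoose_poly k) x = x gchoose k"
  by (simp add: gchoose_poly_def poly_prod gbinomial_prod_rev atLeast0LessThan)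

text \<open>Yields uniqueness: a nonzero difference would have infinitely many roots.\<close>

lemma poly_eq_if_eventually_eq:
  fixes p q :: "real poly"
  assumes "\<And>n. n \<ge> N \<Longrightarrow> poly p (real n) = poly q (real n)"
  shows "p = q"
proof (rule ccontr)
  assume "p \<noteq> q"
  then have "finite {x. poly (p - q) x = 0}"
    by (intro poly_roots_finite) simp
  moreover have "real ` {N..} \<subseteq> {x. poly (p - q) x = 0}"
    using assms by auto
  ultimately have "finite (real ` {N..})"
    using finite_subset by blast
  then show False
    by (simp add: finite_image_iff infinite_Ici)
qed

text \<open>Real division replaces the truncated exponent \<open>n - card S - 1\<close>.\<close>

lemma ex_peak_poly:
  "S \<subseteq> {..k} \<Longrightarrow> \<exists>p::real poly. \<forall>n\<ge>1. S \<subseteq> {..n} \<longrightarrow>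
     real (card (perms_with_peaks S n)) = poly p (real n) * 2 ^ n / 2 ^ (card S + 1)"
proof (induction k arbitrary: S)
  case 0
  then consider "S = {}" | "0 \<in> S" by auto
  then show ?case
  proof cases
    case 1
    have "real (card (perms_with_peaks S n)) = poly 1 (real n) * 2 ^ n / 2 ^ (card S + 1)" if "n \<ge> 1" for n
      using that 1 card_perms_with_peaks_empty[of "n - 1"] by (cases n) auto
    then show ?thesis by blast
  next
    case 2
    then show ?thesis
      by (intro exI[of _ 0]) (simp add: perms_with_peaks_eq_empty)
  qed
next
  case (Suc k)
  show ?case
  \<comment> \<open>The recursion is applied only if \<open>S\<close> contains \<open>Suc k\<close>
    but not \<open>k\<close>, and \<open>k \<noteq> 0\<close>. Otherwise \<open>S\<close> lies in
    \<open>{..k}\<close>, or it contains 1 or two consecutive numbers and every count is 0.\<close>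
  proof (cases "Suc k \<in> S \<and> k \<noteq> 0 \<and> k \<notin> S")
    case False
    then consider "Suc k \<notin> S" | "Suc k \<in> S" "k = 0 \<or> k \<in> S" by blast
    then show ?thesis
    proof cases
      case 1
      with Suc.prems have "S \<subseteq> {..k}" by (auto simp: le_Suc_eq)
      then show ?thesis by (rule Suc.IH)
    next
      case 2
      then have "perms_with_peaks S n = {}" for n
        by (intro perms_with_peaks_eq_empty) auto
      then show ?thesis by (intro exI[of _ 0]) simp
    qed
  next
    case True
    define T where "T = S - {Suc k}"
    have S: "S = insert (Suc k) T"
      using True by (auto simp: T_def)
    have T: "T \<subseteq> {..<k}"
    proof
      fix i assume "i \<in> T"
      then have "i \<le> Suc k" "i \<noteq> Suc k" "i \<noteq> k"
        using True Suc.prems by (auto simp: T_def)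
      then show "i \<in> {..<k}" by simp
    qed
    have fin: "finite T" using T finite_subset by blast
    have cards: "card S = Suc (card T)" "card (insert k T) = Suc (card T)"
      using T fin by (auto simp: S card_insert_if)
    have "T \<subseteq> {..k}" "insert k T \<subseteq> {..k}" using T by auto
    from Suc.IH[OF this(1)] obtain p :: "real poly" where
      p: "\<And>n. n \<ge> 1 \<Longrightarrow> T \<subseteq> {..n} \<Longrightarrow>
        real (card (perms_with_peaks T n)) = poly p (real n) * 2 ^ n / 2 ^ (card T + 1)"
      by blast
    from Suc.IH[OF \<open>insert k T \<subseteq> {..k}\<close>] obtain q :: "real poly" where
      q: "\<And>n. n \<ge> 1 \<Longrightarrow> insert k T \<subseteq> {..n} \<Longrightarrow>
        real (card (perms_with_peaks (insert k T) n)) = poly q (real n) * 2 ^ n / 2 ^ (Suc (card T) + 1)"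
      unfolding cards by blast
    \<comment> \<open>The cut identity solved for \<open>S\<close>. The factor 2 appears because
      \<open>T\<close> has one element fewer than \<open>S\<close> and \<open>insert k T\<close>, so
      its denominator is half as large.\<close>
    define r where "r = smult (poly p (real k)) (gchoose_poly k) - smult 2 p - q"
    have "real (card (perms_with_peaks S n)) = poly r (real n) * 2 ^ n / 2 ^ (card S + 1)"
      if "n \<ge> 1" "S \<subseteq> {..n}" for n
    proof -
      have n: "k < n" using that S by auto
      have "T \<subseteq> {..n}" "insert k T \<subseteq> {..n}" using T n by auto
      note pn = p[OF that(1) this(1)] and qn = q[OF that(1) this(2)]
      have pk: "real (card (perms_with_peaks T k)) = poly p (real k) * 2 ^ k / 2 ^ (card T + 1)"
        using p[of k] True \<open>T \<subseteq> {..k}\<close> by simp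
      have pow: "(2::real) ^ n = 2 * (2 ^ k * 2 ^ (n - Suc k))"
      proof -
        have "n = Suc (k + (n - Suc k))" using n by simp
        then show ?thesis by (metis power_Suc power_add)
      qed
      have "real (card (perms_with_peaks S n)) = real (n choose k) * real (card (perms_with_peaks T k)) * 2 ^ (n - Suc k)
          - real (card (perms_with_peaks T n)) - real (card (perms_with_peaks (insert k T) n))"
        using arg_cong[OF card_perms_with_peaks_rec[OF T n], of real] by (simp add: S)
      also have "\<dots> = poly r (real n) * 2 ^ n / 2 ^ (card S + 1)"
        unfolding pn qn pk r_def
        by (simp add: poly_gchoose_poly binomial_gbinomial cards pow field_simps)
      finally show ?thesis .
    qed
    then show ?thesis by blast
  qed
qed

text \<open>Elements start at 2. The bound makes the exponent \<open>n - card S - 1\<close> exact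
  for \<open>n \<ge> Max S\<close>, which links \<open>peak_poly\<close> to the form with real
  division.\<close>

lemma admissible_card_less_Max:
  assumes "admissible S" "S \<noteq> {}"
  shows "card S < Max S"
proof -
  have S: "finite S" "0 \<notin> S" "1 \<notin> S"
    using assms(1) by (auto simp: admissible_iff)
  have "S \<subseteq> {2..Max S}"
  proof
    fix i assume "i \<in> S"
    with S have "i \<noteq> 0" "i \<noteq> 1" "i \<le> Max S" by (metis, metis, simp)
    then show "i \<in> {2..Max S}" by auto
  qed
  then have "card S \<le> Max S - 1"
    using card_mono[of "{2..Max S}" S] by simp
  moreover have "Max S \<noteq> 0" 
    using S assms(2) Max_in by metis
  ultimately show ?thesis by simp
qed

text \<open>Resolves the definite description once and for all. For non-admissible sets both sides
  are 0. The bound \<open>n \<ge> 1\<close> excludes \<open>n = 0\<close>, where the empty set gives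
  the count 1 but the right-hand side is 1/2.\<close>

lemma card_perms_with_peaks_eq:
  assumes "finite S" "n \<ge> 1" "S \<subseteq> {..n}"
  shows "real (card (perms_with_peaks S n)) = poly (peak_poly S) (real n) * 2 ^ n / 2 ^ (card S + 1)"
proof (cases "admissible S \<and> S \<noteq> {}")
  case False
  then show ?thesis
    using assms card_perms_with_peaks_empty[of "n - 1"] perms_with_peaks_eq_empty[of S n]
    by (cases n; cases "0 \<in> S") (auto simp: peak_poly_def admissible_def)
next
  case True
  have "S \<subseteq> {..Max S}" using assms(1) by auto
  then obtain p :: "real poly" where p: "\<And>n. n \<ge> 1 \<Longrightarrow> S \<subseteq> {..n} \<Longrightarrow>
     real (card (perms_with_peaks S n)) = poly p (real n) * 2 ^ n / 2 ^ (card S + 1)"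
    using ex_peak_poly by blast
  have p': "real (card (perms_with_peaks S n)) = poly p (real n) * 2 ^ (n - card S - 1)" if "n \<ge> Max S" for n
  proof -
    have "card S + 1 \<le> n"
      using admissible_card_less_Max True that by fastforce
    then have "(2::real) ^ n / 2 ^ (card S + 1) = 2 ^ (n - card S - 1)"
      by (simp add: power_diff)
    moreover have "S \<subseteq> {..n}" using \<open>S \<subseteq> {..Max S}\<close> that by fastforce
    ultimately show ?thesis
      using p[of n] \<open>card S + 1 \<le> n\<close> by (metis add_leD2 times_divide_eq_right)
  qed
  have "peak_poly S = p"
    unfolding peak_poly_def using True
  proof (simp, intro the_equality allI impI)
    fix q assume q: "\<forall>n\<ge>Max S. real (card (perms_with_peaks S n)) = poly q (real n) * 2 ^ (n - Suc (card S))"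
    show "q = p"
      by (rule poly_eq_if_eventually_eq[of "Max S"]) (use q p' in simp)
  qed (use p' in simp)
  with p assms show ?thesis by simp
qed

text \<open>A peak needs an entry after it, so no permutation of \<open>{1..k}\<close> has one at
  \<open>k\<close>.\<close>

lemma poly_peak_poly_eq_0:
  assumes "k \<in> S" "S \<subseteq> {..k}" "k \<ge> 1"
  shows "poly (peak_poly S) (real k) = 0"
proof -
  have "finite S" using assms(2) finite_subset by blast
  moreover have "perms_with_peaks S k = {}" using assms(1) perms_with_peaks_eq_empty by blast
  ultimately show ?thesis using card_perms_with_peaks_eq[of S k] assms by simp
qed

text \<open>Comparing values at all \<open>n \<ge> Suc k\<close> turns the cut identity into an
  identity of polynomials, valid also when \<open>insert k S\<close> is not admissible and its
  polynomial is 0.\<close>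

lemma peak_poly_insert_Suc:
  assumes S: "S \<subseteq> {..<k}" and k: "k \<ge> 1"
  shows "peak_poly (insert (Suc k) S) =
    smult (poly (peak_poly S) (real k)) (gchoose_poly k) - smult 2 (peak_poly S) - peak_poly (insert k S)"
    (is "_ = ?r")
proof (rule poly_eq_if_eventually_eq[of "Suc k"])
  fix n assume n: "n \<ge> Suc k"
  have fin: "finite S" using S finite_subset by blast
  have cards: "card (insert (Suc k) S) = Suc (card S)" "card (insert k S) = Suc (card S)"
    using S fin by (auto simp: card_insert_if)
  have sub: "S \<subseteq> {..n}" "insert k S \<subseteq> {..n}" "insert (Suc k) S \<subseteq> {..n}" "S \<subseteq> {..k}"
    using S n by auto
  have pow: "(2::real) ^ n = 2 * (2 ^ k * 2 ^ (n - Suc k))"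
  proof -
    have "n = Suc (k + (n - Suc k))" using n by simp
    then show ?thesis by (metis power_Suc power_add)
  qed
  define r where "r = ?r"
  have "real (card (perms_with_peaks S n)) + real (card (perms_with_peaks (insert k S) n))
      + real (card (perms_with_peaks (insert (Suc k) S) n))
    = real (n choose k) * real (card (perms_with_peaks S k)) * 2 ^ (n - Suc k)"
    using arg_cong[OF card_perms_with_peaks_rec[OF S, of n], of real] n by simp
  then have "2 ^ k * 2 ^ (n - Suc k) * poly (peak_poly (insert (Suc k) S)) (real n)
      = 2 ^ k * 2 ^ (n - Suc k) * poly r (real n)"
    using fin sub n k
    by (simp add: r_def card_perms_with_peaks_eq cards poly_gchoose_poly binomial_gbinomial pow field_simps)
  then show "poly (peak_poly (insert (Suc k) S)) (real n) = poly ?r (real n)"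
    by (simp only: r_def) simp
qed

subsection \<open>The binomial expansion\<close>

text \<open>The elements \<open>i_r\<close> themselves rather than their indices \<open>r\<close>.\<close>

definition odd_gap_elems :: "nat set \<Rightarrow> nat set" where
  "odd_gap_elems S = {a \<in> S. \<exists>c\<in>S. a < c \<and> (\<forall>x\<in>S. \<not> (a < x \<and> x < c)) \<and> odd (c - a)}"

text \<open>The coefficient of \<open>x gchoose j\<close> in the theorem, set to 0 outside the range
  of summation. The condition on \<open>odd_gap_elems\<close> says \<open>b \<le> j\<close> and is
  vacuous without odd gaps, so one formula covers both cases.\<close>

definition trunc_coeff :: "nat set \<Rightarrow> nat \<Rightarrow> real" where
  "trunc_coeff S j =
     (if j < Max S \<and> (\<forall>a\<in>odd_gap_elems S. a \<le> j) then peak_coeff S j else 0)"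

definition const_corr :: "nat set \<Rightarrow> real" where
  "const_corr S = (if odd_gap_elems S = {} then (-2) ^ (card S - 1) else 0)"

lemma odd_gap_elems_less_Max: "finite S \<Longrightarrow> a \<in> odd_gap_elems S \<Longrightarrow> a < Max S"
  by (auto simp: odd_gap_elems_def intro: less_le_trans Max_ge)

lemma odd_gap_elems_singleton [simp]: "odd_gap_elems {m} = {}"
  by (auto simp: odd_gap_elems_def)

lemma odd_gap_elems_insert:
  assumes T: "finite T" "T \<noteq> {}" "Max T < c"
  shows "odd_gap_elems (insert c T) = odd_gap_elems T \<union> (if odd (c - Max T) then {Max T} else {})"
    (is "?L = ?R")
proof
  have less: "x < c" "x \<le> Max T" if "x \<in> T" for x
    using T that Max_ge le_less_trans by blast+
  show "?L \<subseteq> ?R"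
  proof
    fix a assume a: "a \<in> ?L"
    then obtain d where d: "d \<in> insert c T" "a < d" "\<forall>x\<in>insert c T. \<not> (a < x \<and> x < d)" "odd (d - a)"
      by (auto simp: odd_gap_elems_def)
    have aT: "a \<in> T"
      using a d less by (auto simp: odd_gap_elems_def dest: less_asym)
    show "a \<in> ?R"
    proof (cases "d = c")
      case True
      have "a = Max T"
        using d(3) less[OF aT] T True Max_in[of T] by (meson insertI2 le_neq_implies_less)
      with True d show ?thesis by simp
    next
      case False
      with d aT show ?thesis by (auto simp: odd_gap_elems_def)
    qed
  qed
  show "?R \<subseteq> ?L"
  proof
    fix a assume "a \<in> ?R"
    then consider "a \<in> odd_gap_elems T" | "odd (c - Max T)" "a = Max T"
      by (auto split: if_splits)
    then show "a \<in> ?L"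
    proof cases
      case 1
      then obtain d where d: "a \<in> T" "d \<in> T" "a < d" "\<forall>x\<in>T. \<not> (a < x \<and> x < d)" "odd (d - a)"
        by (auto simp: odd_gap_elems_def)
      moreover have "\<not> c < d" using less(1)[OF d(2)] by simp
      ultimately show ?thesis
        unfolding odd_gap_elems_def by blast
    next
      case 2
      then show ?thesis
        using T less(2) Max_in[of T] unfolding odd_gap_elems_def by (auto simp: not_less)
    qed
  qed
qed

lemma admissible_subset: "admissible S \<Longrightarrow> T \<subseteq> S \<Longrightarrow> admissible T"
  by (auto simp: admissible_iff intro: finite_subset)

lemma peak_poly_empty [simp]: "peak_poly {} = 1"
  by (simp add: peak_poly_def admissible_iff)

lemma peak_coeff_singleton: "j < m \<Longrightarrow> peak_coeff {m} j = (-1) ^ (m - j - 1)"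
proof -
  assume "j < m"
  then have "{m} \<inter> {j<..} = {m}" "{m} \<inter> {1..j} = {}" by auto
  then show ?thesis by (simp add: peak_coeff_def)
qed

text \<open>Lets expansions of sets with different maxima be compared over one range of
  \<open>j\<close>.\<close>

lemma sum_trunc_coeff:
  assumes "Max S \<le> N"
  shows "(\<Sum>j<Max S. trunc_coeff S j * f j) = (\<Sum>j<N. trunc_coeff S j * f j)"
  using assms by (intro sum.mono_neutral_left) (auto simp: trunc_coeff_def)

section \<open>Coefficients after inserting a new largest peak\<close>

context
  fixes T :: "nat set" and k :: nat
  assumes T: "T \<subseteq> {..<k}" and k: "k \<ge> 1" and T0: "0 \<notin> T"
begin

lemma finite_of_below: "finite T"
  using T finite_subset by blast

lemma bounds_of_below: "x \<in> T \<Longrightarrow> 1 \<le> x \<and> x < k"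
  using T T0 by (cases x) auto

lemma Max_insert_eq: "Max (insert k T) = k" "Max (insert (Suc k) T) = Suc k"
  using finite_of_below T by (auto intro!: Max_eqI)

lemma card_insert_greaterThan:
  assumes "j < c" "c \<notin> T"
  shows "card (insert c T \<inter> {j<..}) = Suc (card (T \<inter> {j<..}))"
  using assms finite_of_below by (simp add: Int_insert_left)

text \<open>Identifies the binomial term of the recursion with the top term \<open>j = k\<close> of
  the expansion.\<close>

lemma peak_coeff_insert_top: "peak_coeff (insert (Suc k) T) k = poly (peak_poly T) (real k)"
proof -
  have i: "insert (Suc k) T \<inter> {k<..} = {Suc k}" "insert (Suc k) T \<inter> {1..k} = T"
    using bounds_of_below by (auto simp: less_imp_le dest: less_asym)
  show ?thesis unfolding peak_coeff_def Max_insert_eq i by simp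
qed

text \<open>The part of the set up to \<open>j\<close> and the number of elements above
  \<open>j\<close> stay the same; only the exponent of -1 changes.\<close>

lemma peak_coeff_insert_shift:
  assumes "j < k"
  shows "peak_coeff (insert k T) j = - peak_coeff (insert (Suc k) T) j"
proof -
  have "k \<notin> T" "Suc k \<notin> T" using T by auto
  then have c: "card (insert k T \<inter> {j<..}) = card (insert (Suc k) T \<inter> {j<..})"
    using card_insert_greaterThan[of j k] card_insert_greaterThan[of j "Suc k"] assms
    by (metis less_SucI)
  have i: "insert k T \<inter> {1..j} = insert (Suc k) T \<inter> {1..j}" using assms by auto
  have e: "Suc k - j - 1 = Suc (k - j - 1)" using assms by simp
  show ?thesis
    unfolding peak_coeff_def Max_insert_eq c i e by simp
qed

text \<open>As \<open>Max T\<close> lies above \<open>j\<close>, the new element adds one to a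
  positive count and gives a factor -2; the sign comes from the difference of the maxima.\<close>

lemma peak_coeff_insert_below:
  assumes "j < Max T" "T \<noteq> {}"
  shows "peak_coeff (insert (Suc k) T) j = (-1) ^ (Suc k - Max T) * (-2) * peak_coeff T j"
proof -
  have M: "Max T \<in> T" using finite_of_below assms(2) by simp
  then have "Max T < k" using T by auto
  have "Suc k \<notin> T" using T by auto
  then have c: "card (insert (Suc k) T \<inter> {j<..}) - 1 = card (T \<inter> {j<..})"
    using card_insert_greaterThan[of j "Suc k"] assms \<open>Max T < k\<close> by simp
  have i: "insert (Suc k) T \<inter> {1..j} = T \<inter> {1..j}" using assms \<open>Max T < k\<close> by auto
  have "Suc k - j - 1 = (Suc k - Max T) + (Max T - j - 1)" using assms \<open>Max T < k\<close> by simp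
  then have e: "(-1::real) ^ (Suc k - j - 1) = (-1) ^ (Suc k - Max T) * (-1) ^ (Max T - j - 1)"
    by (simp only: power_add)
  have "Max T \<in> T \<inter> {j<..}"
    using M assms by simp
  then have "card (T \<inter> {j<..}) \<noteq> 0"
    using finite_of_below by (metis card_0_eq empty_iff finite_Int)
  then have p: "(-2::real) ^ card (T \<inter> {j<..}) = (-2) * (-2) ^ (card (T \<inter> {j<..}) - 1)"
    by (metis power_eq_if)
  show ?thesis
    unfolding peak_coeff_def Max_insert_eq c i e p by simp
qed

text \<open>The elements up to \<open>Max T\<close> form \<open>T\<close> itself, whose polynomial
  vanishes at its maximum.\<close>

lemma peak_coeff_insert_at_Max:
  assumes "T \<noteq> {}"
  shows "peak_coeff (insert (Suc k) T) (Max T) = 0"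
proof -
  have M: "Max T \<in> T" using finite_of_below assms by simp
  then have "Max T < k" using T by auto
  have "insert (Suc k) T \<inter> {1..Max T} = T"
    using bounds_of_below finite_of_below \<open>Max T < k\<close> by auto
  moreover have "poly (peak_poly T) (real (Max T)) = 0"
    using M bounds_of_below finite_of_below by (intro poly_peak_poly_eq_0) auto
  ultimately show ?thesis by (simp add: peak_coeff_def)
qed

end

text \<open>An odd new gap removes the correction; an even one only raises the exponent of -2 by
  one.\<close>

lemma const_corr_insert:
  assumes "finite T" "T \<noteq> {}" "Max T < c"
  shows "const_corr (insert c T) = (if odd (c - Max T) then 0 else -2 * const_corr T)"
proof -
  have "c \<notin> T" using assms Max_ge not_less by blast
  moreover have "card T \<noteq> 0" using assms by simp
  then have "(-2::real) ^ card T = -2 * (-2) ^ (card T - 1)"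
    by (metis power_eq_if)
  ultimately show ?thesis
    using assms by (simp add: const_corr_def odd_gap_elems_insert)
qed

text \<open>Both cases of the theorem in one formula. Strong induction on \<open>Max S\<close>
  supplies the expansions of a nonempty \<open>T\<close> and of an admissible \<open>U\<close>,
  whose maxima are smaller.\<close>

lemma poly_peak_poly_trunc_coeff:
  assumes "admissible S" "S \<noteq> {}"
  shows "poly (peak_poly S) x = (\<Sum>j<Max S. trunc_coeff S j * (x gchoose j)) - const_corr S"
  using assms
proof (induction "Max S" arbitrary: S rule: less_induct)
  case less
  have adm: "finite S" "0 \<notin> S" "1 \<notin> S" "\<And>i. i \<in> S \<Longrightarrow> Suc i \<notin> S"
    using less.prems by (auto simp: admissible_iff)
  have MS: "Max S \<in> S" using adm less.prems by simp
  define k where "k = Max S - 1"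
  define T where "T = S - {Max S}"
  have mk: "Max S = Suc k" and k: "k \<ge> 1"
  proof -
    have "Max S \<noteq> 0" "Max S \<noteq> 1" using MS adm by metis+
    then show "Max S = Suc k" "k \<ge> 1" by (simp_all add: k_def)
  qed
  have S: "S = insert (Suc k) T"
    using MS mk by (auto simp: T_def)
  have "k \<notin> S" using MS adm(4) mk by auto
  have T: "T \<subseteq> {..<k}"
  proof
    fix i assume "i \<in> T"
    then have "i \<le> Suc k" "i \<noteq> Suc k" "i \<noteq> k"
      using \<open>k \<notin> S\<close> adm(1) by (auto simp: T_def simp flip: mk)
    then show "i \<in> {..<k}" by simp
  qed
  have T0: "0 \<notin> T" and fT: "finite T" using adm by (auto simp: T_def)
  define U where "U = insert k T"
  have MU: "Max U = k" unfolding U_def by (rule Max_insert_eq[OF T k T0])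
  \<comment> \<open>\<open>U\<close> can fail to be admissible only by containing 1 or the pair
    \<open>k - 1\<close>, \<open>k\<close>.\<close>
  have U: "admissible U" if "k \<noteq> 1" "k - 1 \<notin> T"
  proof -
    have "Suc i \<noteq> k" if "i \<in> T" for i using that \<open>k - 1 \<notin> T\<close> by auto
    moreover have "Suc k \<notin> T" using T by auto
    ultimately show ?thesis
      using adm k that by (auto simp: admissible_iff U_def T_def)
  qed
  have rec: "poly (peak_poly S) x
    = peak_coeff S k * (x gchoose k) - 2 * poly (peak_poly T) x - poly (peak_poly U) x"
    unfolding S U_def by (simp add: peak_poly_insert_Suc[OF T k] poly_gchoose_poly peak_coeff_insert_top[OF T k T0])
  \<comment> \<open>Coefficients and correction of \<open>U\<close>, with default 0 for
    non-admissible \<open>U\<close>, so that \<open>U_eq\<close> holds in either case.\<close>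
  define V where "V j = (if admissible U then trunc_coeff U j else 0)" for j
  define v where "v = (if admissible U then const_corr U else 0)"
  have U_eq: "poly (peak_poly U) x = (\<Sum>j<Suc k. V j * (x gchoose j)) - v"
  proof (cases "admissible U")
    case True
    have "poly (peak_poly U) x = (\<Sum>j<Max U. trunc_coeff U j * (x gchoose j)) - const_corr U"
      using True by (intro less.hyps) (auto simp: MU mk, simp add: U_def)
    then show ?thesis
      using True sum_trunc_coeff[of U "Suc k"] by (simp add: V_def v_def MU)
  qed (simp add: peak_poly_def V_def v_def)
  show ?case
  proof (cases "T = {}")
    case True
    have S': "S = {Suc k}" and U': "U = {k}" using S True by (auto simp: U_def)
    have adm_U: "admissible U \<longleftrightarrow> k \<noteq> 1"
      using k by (auto simp: admissible_iff U')
    have S_sum: "(\<Sum>j<Max S. trunc_coeff S j * (x gchoose j)) =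
        (\<Sum>j<k. peak_coeff S j * (x gchoose j)) + peak_coeff S k * (x gchoose k)"
      by (simp add: S' trunc_coeff_def)
    show ?thesis
    proof (cases "k = 1")
      case True
      \<comment> \<open>Here \<open>S = {2}\<close>, and \<open>U = {1}\<close> is not admissible,
        so the recursion reads x - 2.\<close>
      then show ?thesis
        unfolding rec S_sum using adm_U \<open>T = {}\<close>
        by (simp add: peak_poly_def[of U] const_corr_def S' peak_coeff_singleton)
    next
      case False
      have "V j = (if j < k then - peak_coeff S j else 0)" for j
        using False adm_U peak_coeff_insert_shift[OF T k T0, of j]
        by (simp add: V_def trunc_coeff_def MU S U_def \<open>T = {}\<close>)
      then have "poly (peak_poly U) x = - (\<Sum>j<k. peak_coeff S j * (x gchoose j)) - v"
        unfolding U_eq by (simp add: sum_negf)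
      \<comment> \<open>The constants combine: -2 from the polynomial 1 of the empty set, plus the
        correction 1 of \<open>U\<close>, leaves minus the correction 1 of \<open>S\<close>.\<close>
      moreover have "v = 1"
        using False adm_U by (simp add: v_def const_corr_def U')
      moreover have "const_corr S = 1" by (simp add: const_corr_def S')
      ultimately show ?thesis
        unfolding S_sum rec by (simp add: \<open>T = {}\<close>)
    qed
  next
    case False
    define m where "m = Max T"
    have "m \<in> T" using False fT by (simp add: m_def)
    then have mk': "m < k" using T by auto
    have below: "peak_coeff S j = (-1) ^ (Suc k - m) * (-2) * peak_coeff T j" if "j < m" for j
      using peak_coeff_insert_below[OF T k T0, of j] that False by (simp add: S m_def)
    have at: "peak_coeff S m = 0"
      using peak_coeff_insert_at_Max[OF T k T0 False] by (simp add: S m_def)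
    have shift: "peak_coeff U j = - peak_coeff S j" if "j < k" for j
      using peak_coeff_insert_shift[OF T k T0 that] by (simp add: S U_def)
    have ogS: "odd_gap_elems S = odd_gap_elems T \<union> (if odd (Suc k - m) then {m} else {})"
      using odd_gap_elems_insert[OF fT False, of "Suc k"] mk' by (simp add: S m_def)
    have ogU: "odd_gap_elems U = odd_gap_elems T \<union> (if even (Suc k - m) then {m} else {})"
      using odd_gap_elems_insert[OF fT False, of k] mk' by (simp add: U_def m_def Suc_diff_le)
    have ogT: "a < m" if "a \<in> odd_gap_elems T" for a
      using odd_gap_elems_less_Max[OF fT that] by (simp add: m_def)
    have cS: "const_corr S = (if odd (Suc k - m) then 0 else -2 * const_corr T)"
      using const_corr_insert[OF fT False, of "Suc k"] mk' by (simp add: S m_def)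
    have cU: "const_corr U = (if even (Suc k - m) then 0 else -2 * const_corr T)"
      using const_corr_insert[OF fT False, of k] mk' by (simp add: U_def m_def Suc_diff_le)
    have T_eq: "poly (peak_poly T) x = (\<Sum>j<Suc k. trunc_coeff T j * (x gchoose j)) - const_corr T"
    proof -
      have "admissible T" using admissible_subset less.prems(1) by (auto simp: T_def)
      then have "poly (peak_poly T) x = (\<Sum>j<Max T. trunc_coeff T j * (x gchoose j)) - const_corr T"
        using False mk' by (intro less.hyps) (auto simp: mk m_def)
      then show ?thesis
        using sum_trunc_coeff[of T "Suc k"] mk' by (simp add: m_def)
    qed
    \<comment> \<open>A non-admissible \<open>U\<close> contains both \<open>m\<close> and
      \<open>k = Suc m\<close>, so the last gap of \<open>S\<close> is 2. For an even gap an
      admissible \<open>U\<close> contributes nothing below \<open>m\<close> and no correction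
      either, so the default 0 is the right value.\<close>
    have not_adm: "k = Suc m \<and> even (Suc k - m)" if "\<not> admissible U"
    proof -
      have "k - 1 \<in> T" using U that \<open>m \<in> T\<close> T0 mk' by (cases "k = 1") auto
      then have "k - 1 \<le> m" using fT by (simp add: m_def)
      with mk' have "k = Suc m" by simp
      then show ?thesis by simp
    qed
    have coeff: "trunc_coeff S j = (if j = k then peak_coeff S k else 0) - 2 * trunc_coeff T j - V j"
      if j: "j < Suc k" for j
    proof -
      consider "j < m" | "j = m" | "m < j" "j < k" | "j = k" using j by linarith
      then show ?thesis
      proof cases
        \<comment> \<open>Below \<open>m\<close>: for an even last gap \<open>U\<close> contributes
          nothing, and -2 times the coefficient of \<open>T\<close> is that of \<open>S\<close>. For
          an odd one the truncated coefficient of \<open>S\<close> is 0, and the terms of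
          \<open>T\<close> and \<open>U\<close> cancel.\<close>
        case 1
        then have V: "V j = (if even (Suc k - m) \<or> \<not> (\<forall>a\<in>odd_gap_elems T. a \<le> j) then 0 else - peak_coeff S j)"
          using not_adm mk' shift[of j] by (auto simp: V_def trunc_coeff_def ogU MU)
        show ?thesis
          unfolding V using 1 mk' below[OF 1]
          by (auto simp: trunc_coeff_def ogS mk m_def[symmetric])
      next
        case 2
        then show ?thesis
          using mk' at shift[of m] by (simp add: trunc_coeff_def V_def m_def[symmetric])
      next
        \<comment> \<open>Between \<open>m\<close> and \<open>k\<close> only \<open>U\<close>
          contributes, with the flipped sign.\<close>
        case 3
        then have "admissible U" using not_adm by fastforce
        with 3 have "V j = - peak_coeff S j"
          using shift[of j] ogT by (force simp: V_def trunc_coeff_def ogU MU)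
        moreover have "trunc_coeff S j = peak_coeff S j"
          using 3 ogT by (force simp: trunc_coeff_def ogS mk)
        ultimately show ?thesis
          using 3 by (simp add: trunc_coeff_def m_def[symmetric])
      next
        case 4
        have "trunc_coeff S j = peak_coeff S j"
          using 4 mk' ogT by (force simp: trunc_coeff_def ogS mk)
        then show ?thesis
          using 4 mk' by (simp add: trunc_coeff_def V_def m_def[symmetric] MU)
      qed
    qed
    \<comment> \<open>The same parity split: for an even last gap only \<open>T\<close> contributes,
      for an odd one the two corrections cancel.\<close>
    have const: "const_corr S = - 2 * const_corr T - v"
      using cS cU not_adm by (auto simp: v_def)
    have "(\<Sum>j<Suc k. trunc_coeff S j * (x gchoose j)) =
       (\<Sum>j<Suc k. (if j = k then peak_coeff S k * (x gchoose k) else 0) 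
           - 2 * (trunc_coeff T j * (x gchoose j)) - V j * (x gchoose j))"
      by (intro sum.cong refl) (simp add: coeff algebra_simps del: sum.lessThan_Suc)
    also have "\<dots> = peak_coeff S k * (x gchoose k)
        - 2 * (\<Sum>j<Suc k. trunc_coeff T j * (x gchoose j)) - (\<Sum>j<Suc k. V j * (x gchoose j))"
      by (simp only: sum_subtractf sum_distrib_left[symmetric] sum.delta finite_lessThan) simp
    finally show ?thesis
      unfolding mk rec T_eq U_eq const by simp
  qed
qed

section \<open>Passing between odd gap indices and odd gap elements\<close>

lemma nth_sorted_list_of_set_less_iff:
  assumes "finite (S :: nat set)" "i < card S" "j < card S"
  shows "sorted_list_of_set S ! i < sorted_list_of_set S ! j \<longleftrightarrow> i < j"
proof -
  have "sorted_wrt (<) (sorted_list_of_set S)"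
    by (rule strict_sorted_list_of_set)
  then show ?thesis
    using assms sorted_wrt_nth_less[of "(<)" "sorted_list_of_set S"]
    by (metis length_sorted_list_of_set less_asym less_irrefl linorder_neqE_nat)
qed

text \<open>Elements of \<open>S\<close> with no other element between them are consecutive entries
  of its sorted list.\<close>

lemma odd_gap_elems_eq_image:
  assumes S: "finite S"
  shows "odd_gap_elems S = nth_elem S ` odd_gap_indices S"
proof -
  let ?xs = "sorted_list_of_set S"
  have len: "length ?xs = card S" and set: "set ?xs = S" using S by simp_all
  have mem: "\<exists>i<card S. ?xs ! i = x" if "x \<in> S" for x
    using that len set by (metis in_set_conv_nth)
  note less_iff = nth_sorted_list_of_set_less_iff[OF S]
  show ?thesis
  proof
    show "odd_gap_elems S \<subseteq> nth_elem S ` odd_gap_indices S"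
    proof
      fix a assume "a \<in> odd_gap_elems S"
      then obtain c where a: "a \<in> S" and c: "c \<in> S" "a < c" "\<forall>x\<in>S. \<not> (a < x \<and> x < c)" "odd (c - a)"
        by (auto simp: odd_gap_elems_def)
      obtain i l where i: "i < card S" "?xs ! i = a" and l: "l < card S" "?xs ! l = c"
        using mem a c(1) by metis
      have "i < l" using less_iff[OF i(1) l(1)] i l c(2) by simp
      have "\<not> Suc i < l"
      proof
        assume "Suc i < l"
        then have "Suc i < card S" using l by simp
        then have "?xs ! Suc i \<in> S" using len set by (metis nth_mem)
        moreover have "a < ?xs ! Suc i" "?xs ! Suc i < c"
          using less_iff[OF i(1) \<open>Suc i < card S\<close>] less_iff[OF \<open>Suc i < card S\<close> l(1)] i l \<open>Suc i < l\<close>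
          by auto
        ultimately show False using c(3) by blast
      qed
      with \<open>i < l\<close> have "l = Suc i" by simp
      \<comment> \<open>Ranks start at 1, so list position \<open>i\<close> belongs to index
        \<open>Suc i\<close>.\<close>
      then have "Suc i \<in> odd_gap_indices S" "nth_elem S (Suc i) = a"
        using i l c by (auto simp: odd_gap_indices_def nth_elem_def)
      then show "a \<in> nth_elem S ` odd_gap_indices S" by blast
    qed
    show "nth_elem S ` odd_gap_indices S \<subseteq> odd_gap_elems S"
    proof clarify
      fix r assume "r \<in> odd_gap_indices S"
      then have r: "1 \<le> r" "r < card S" "odd (?xs ! r - ?xs ! (r - 1))"
        by (auto simp: odd_gap_indices_def nth_elem_def)
      then have r': "r - 1 < card S" by simp
      have "?xs ! (r - 1) \<in> S" "?xs ! r \<in> S"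
        using r r' len set by (metis nth_mem)+
      moreover have "?xs ! (r - 1) < ?xs ! r"
        using less_iff[OF r' r(2)] r(1) by simp
      moreover have "\<not> (?xs ! (r - 1) < x \<and> x < ?xs ! r)" if x: "x \<in> S" for x
      proof -
        obtain i where "i < card S" "?xs ! i = x" using mem[OF x] by blast
        then show ?thesis using less_iff[OF r'] less_iff[OF _ r(2)] by fastforce
      qed
      ultimately show "nth_elem S r \<in> odd_gap_elems S"
        using r by (auto simp: odd_gap_elems_def nth_elem_def)
    qed
  qed
qed

text \<open>Elements increase with their rank, so the largest index gives the largest element; this
  turns the condition in \<open>trunc_coeff\<close> into \<open>b \<le> j\<close>.\<close>

lemma odd_gap_elems_le_iff:
  assumes S: "finite S" and ne: "odd_gap_indices S \<noteq> {}"
  shows "(\<forall>a\<in>odd_gap_elems S. a \<le> j) \<longleftrightarrow> nth_elem S (Max (odd_gap_indices S)) \<le> j"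
proof -
  have sub: "odd_gap_indices S \<subseteq> {1..card S - 1}"
    by (auto simp: odd_gap_indices_def)
  then have fin: "finite (odd_gap_indices S)" using finite_subset by blast
  have mono: "nth_elem S r \<le> nth_elem S (Max (odd_gap_indices S))" if "r \<in> odd_gap_indices S" for r
  proof -
    have "r \<le> Max (odd_gap_indices S)" using fin that by simp
    moreover have "Max (odd_gap_indices S) - 1 < length (sorted_list_of_set S)"
      using Max_in[OF fin ne] sub S by fastforce
    ultimately show ?thesis
      unfolding nth_elem_def by (intro sorted_nth_mono) auto
  qed
  then show ?thesis
    using Max_in[OF fin ne] unfolding odd_gap_elems_eq_image[OF S] by (auto intro: le_trans)
qed

theorem theorem1p2:
  fixes S :: "nat set"
  assumes "admissible S" and "S \<noteq> {}"
  shows "(odd_gap_indices S \<noteq> {} \<longrightarrow>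
           (let b = nth_elem S (Max (odd_gap_indices S)) in
             \<forall>x::real. poly (peak_poly S) x
               = (\<Sum>j=b..Max S - 1. peak_coeff S j * (x gchoose j))))
       \<and> (odd_gap_indices S = {} \<longrightarrow>
           (\<forall>x::real. poly (peak_poly S) x
               = (peak_coeff S 0 - (-2) ^ (card S - 1))
                 + (\<Sum>j=1..Max S - 1. peak_coeff S j * (x gchoose j))))"
proof -
  have fin: "finite S" using assms by (simp add: admissible_iff)
  have pos: "Max S > 0" using admissible_card_less_Max[OF assms] by simp
  note eq = poly_peak_poly_trunc_coeff[OF assms]
  have empty_iff: "odd_gap_elems S = {} \<longleftrightarrow> odd_gap_indices S = {}"
    by (simp add: odd_gap_elems_eq_image[OF fin])
  show ?thesis
  proof (intro conjI impI)
    assume ne: "odd_gap_indices S \<noteq> {}"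
    define b where "b = nth_elem S (Max (odd_gap_indices S))"
    have "poly (peak_poly S) x = (\<Sum>j=b..Max S - 1. peak_coeff S j * (x gchoose j))" for x
    proof -
      have "poly (peak_poly S) x = (\<Sum>j<Max S. trunc_coeff S j * (x gchoose j))"
        unfolding eq using ne empty_iff by (simp add: const_corr_def)
      \<comment> \<open>The terms below \<open>b\<close> vanish by truncation.\<close>
      also have "\<dots> = (\<Sum>j=b..Max S - 1. peak_coeff S j * (x gchoose j))"
        using pos by (intro sum.mono_neutral_cong_right)
          (auto simp: trunc_coeff_def odd_gap_elems_le_iff[OF fin ne] b_def)
      finally show ?thesis .
    qed
    then show "let b = nth_elem S (Max (odd_gap_indices S)) in
             \<forall>x::real. poly (peak_poly S) x
               = (\<Sum>j=b..Max S - 1. peak_coeff S j * (x gchoose j))"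
      by (simp add: b_def)
  next
    assume "odd_gap_indices S = {}"
    with empty_iff have e: "odd_gap_elems S = {}" by simp
    \<comment> \<open>The term \<open>j = 0\<close> is split off: \<open>x gchoose 0\<close> is 1,
      so the correction joins its coefficient.\<close>
    have "{..<Max S} = insert 0 {1..Max S - 1}" using pos by auto
    moreover have "(\<Sum>j=1..Max S - 1. trunc_coeff S j * (x gchoose j))
        = (\<Sum>j=1..Max S - 1. peak_coeff S j * (x gchoose j))" for x
      using pos by (intro sum.cong) (auto simp: trunc_coeff_def e)
    moreover have "trunc_coeff S 0 = peak_coeff S 0"
      using pos by (simp add: trunc_coeff_def e)
    ultimately show "\<forall>x::real. poly (peak_poly S) x
               = (peak_coeff S 0 - (-2) ^ (card S - 1))
                 + (\<Sum>j=1..Max S - 1. peak_coeff S j * (x gchoose j))"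
      unfolding eq by (simp add: const_corr_def e)
  qed
qed

end
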